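(* Let $r\ge 2$ be an integer, and for $p=p(n)$ let $[n]_p$ be the random subset of $[n]$ obtained by including each integer independently with probability $p$. Then (0) if $p=o(n^{-1/S'(r)})$, then $\lim_{n\to\infty}\Pr([n]_p\text{ is } r\text{-product-Schur})=0$; (1) if $p=\omega(n^{-1/S(r)^2})$, then $\lim_{n\to\infty}\Pr([n]_p\text{ is } r\text{-product-Schur})=1$.
   Context: A set $A\subseteq\mathbb{N}$ is $r$-product-Schur if every $r$-colouring of $A$ yields $a,b,c\in A$ of the same colour with $ab=c$ ($a=b$ allowed). The Schur number $S(r)$ is the minimum $n$ such that every $r$-colouring of $[n]$ contains a monochromatic triple $(a,b,c)\in[n]^3$ with $a+b=c$. The double-sum Schur number $S'(r)$ is the minimum $n$ such that every $r$-colouring of $[n]$ contains either a monochromatic $(a,b,c)\in[n]^3$ with $a+b=c$ or a monochromatic $(a,b,c)\in[n]^3$ with $a+b=c-1$. *)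

theory Defs
  imports "HOL-Probability.Probability" "HOL-Library.Landau_Symbols"
begin

definition colouring :: "nat \<Rightarrow> nat set \<Rightarrow> (nat \<Rightarrow> nat) \<Rightarrow> bool" where
  "colouring r A \<kappa> \<longleftrightarrow> (\<forall>x\<in>A. \<kappa> x < r)"

definition product_Schur :: "nat \<Rightarrow> nat set \<Rightarrow> bool" where
  "product_Schur r A \<longleftrightarrow>
     (\<forall>\<kappa>. colouring r A \<kappa> \<longrightarrow>
        (\<exists>a\<in>A. \<exists>b\<in>A. \<exists>c\<in>A. \<kappa> a = \<kappa> b \<and> \<kappa> b = \<kappa> c \<and> a * b = c))"

(* The minimum exists for every r by Schur's theorem, so LEAST is meaningful here and in
   double_sum_Schur_number, whose condition on n is weaker. *)
definition Schur_number :: "nat \<Rightarrow> nat" where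
  "Schur_number r =
     (LEAST n. \<forall>\<kappa>. colouring r {1..n} \<kappa> \<longrightarrow>
        (\<exists>a\<in>{1..n}. \<exists>b\<in>{1..n}. \<exists>c\<in>{1..n}. \<kappa> a = \<kappa> b \<and> \<kappa> b = \<kappa> c \<and> a + b = c))"

(* c \<ge> 1, so the subtraction on nat is not truncated. *)
definition double_sum_Schur_number :: "nat \<Rightarrow> nat" where
  "double_sum_Schur_number r =
     (LEAST n. \<forall>\<kappa>. colouring r {1..n} \<kappa> \<longrightarrow>
        (\<exists>a\<in>{1..n}. \<exists>b\<in>{1..n}. \<exists>c\<in>{1..n}. \<kappa> a = \<kappa> b \<and> \<kappa> b = \<kappa> c \<and> a + b = c) \<or>
        (\<exists>a\<in>{1..n}. \<exists>b\<in>{1..n}. \<exists>c\<in>{1..n}. \<kappa> a = \<kappa> b \<and> \<kappa> b = \<kappa> c \<and> a + b = c - 1))"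

(* Coordinates of the product distribution are independent; False is only the value
   outside {1..n}. *)
definition random_subset :: "nat \<Rightarrow> real \<Rightarrow> nat set pmf" where
  "random_subset n p =
     map_pmf (\<lambda>f. {i \<in> {1..n}. f i}) (Pi_pmf {1..n} False (\<lambda>_. bernoulli_pmf p))"

end

theory Submission
  imports Defs "HOL-Library.Ramsey"
begin

text \<open>Both thresholds come from transporting sums to products through exponents. Below the lower one,
  the random set with high probability avoids the integers up to \<open>n\<^bsup>1/S'(r)\<^esup>\<close>, so \<open>\<lfloor>S'(r) log\<^sub>n x\<rfloor>\<close>
  lies in \<open>{1..<S'(r)}\<close> for all its elements \<open>x\<close>, and a colouring without double sums of that
  interval pulls back to one without product triples. Above the upper one, it contains with high probability
  all of \<open>x, x\<^sup>2, \<dots>, x\<^bsup>S(r)\<^esup>\<close> for some \<open>x\<close>. To make these events independent for different \<open>x\<close>, only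
  \<open>x \<equiv> 2 (mod 4)\<close> are considered, for which the sets of powers are disjoint.\<close>

section \<open>Existence of Schur numbers\<close>

text \<open>Colour each pair of integers by the colour of its difference. Ramsey's theorem yields a
  monochromatic triangle x < y < z, and (y - x) + (z - y) = z - x is the sum sought.\<close>

lemma Schur_theorem:
  "\<exists>n. \<forall>\<kappa>. colouring r {1..n} \<kappa> \<longrightarrow>
     (\<exists>a\<in>{1..n}. \<exists>b\<in>{1..n}. \<exists>c\<in>{1..n}. \<kappa> a = \<kappa> b \<and> \<kappa> b = \<kappa> c \<and> a + b = c)"
proof -
  \<comment> \<open>The list of \<open>r\<close> threes asks for a triangle in one of
    \<open>r\<close> colours, and 2 says that pairs are coloured. Distinct vertices in
    \<open>{..<N}\<close> differ by less than \<open>N\<close>, so every difference has a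
    colour.\<close>
  obtain N :: nat where N: "partn_lst {..<N} (replicate r 3) 2"
    using ramsey_full by blast
  have "\<exists>a\<in>{1..N}. \<exists>b\<in>{1..N}. \<exists>c\<in>{1..N}. \<kappa> a = \<kappa> b \<and> \<kappa> b = \<kappa> c \<and> a + b = c"
    if \<kappa>: "colouring r {1..N} \<kappa>" for \<kappa>
  proof -
    define f where "f = (\<lambda>e::nat set. \<kappa> (Max e - Min e))"
    have f_pair: "f {x, y} = \<kappa> (y - x)" if "x < y" for x y
      using that by (simp add: f_def max_def min_def)
    have "\<kappa> (y - x) < r" if "x < y" "y < N" for x y
    proof -
      have "y - x \<in> {1..N}" using that by auto
      then show ?thesis using \<kappa> unfolding colouring_def by blast
    qed
    then have "f \<in> nsets {..<N} 2 \<rightarrow> {..<r}"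
      by (auto simp: ordered_nsets_2_eq f_pair)
    then obtain i H where H: "H \<in> nsets {..<N} 3" and fH: "f ` nsets H 2 \<subseteq> {i}"
      using partn_lstE[OF N] by (metis length_replicate nth_replicate)
    obtain x y z where xyz: "H = {x, y, z}" "x < y" "y < z" "z < N"
      using H by (auto simp: ordered_nsets_3_eq)
    then have "{x, y} \<in> nsets H 2" "{y, z} \<in> nsets H 2" "{x, z} \<in> nsets H 2"
      by auto
    then have "f {x, y} = i" "f {y, z} = i" "f {x, z} = i"
      using fH by blast+
    then have "\<kappa> (y - x) = i" "\<kappa> (z - y) = i" "\<kappa> (z - x) = i"
      using xyz f_pair by auto
    then show ?thesis
      using xyz by (intro bexI[of _ "y - x"] bexI[of _ "z - y"] bexI[of _ "z - x"]) auto
  qed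
  then show ?thesis by blast
qed

lemma Schur_number_triple:
  assumes "colouring r {1..Schur_number r} \<kappa>"
  obtains a b where "a \<ge> 1" "b \<ge> 1" "a + b \<le> Schur_number r" "\<kappa> a = \<kappa> b" "\<kappa> b = \<kappa> (a + b)"
proof -
  have "\<exists>a\<in>{1..Schur_number r}. \<exists>b\<in>{1..Schur_number r}. \<exists>c\<in>{1..Schur_number r}.
          \<kappa> a = \<kappa> b \<and> \<kappa> b = \<kappa> c \<and> a + b = c"
    using LeastI_ex[OF Schur_theorem[of r]] assms unfolding Schur_number_def by blast
  then show ?thesis using that by auto
qed

lemma Schur_number_pos: "Schur_number r > 0"
proof (rule ccontr)
  assume "\<not> Schur_number r > 0"
  then have "colouring r {1..Schur_number r} id" by (simp add: colouring_def)
  then show False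
    using \<open>\<not> Schur_number r > 0\<close> by (elim Schur_number_triple) auto
qed

lemma double_sum_Schur_number_pos: "double_sum_Schur_number r > 0"
proof -
  let ?P = "\<lambda>n. \<forall>\<kappa>. colouring r {1..n} \<kappa> \<longrightarrow>
        (\<exists>a\<in>{1..n}. \<exists>b\<in>{1..n}. \<exists>c\<in>{1..n}. \<kappa> a = \<kappa> b \<and> \<kappa> b = \<kappa> c \<and> a + b = c) \<or>
        (\<exists>a\<in>{1..n}. \<exists>b\<in>{1..n}. \<exists>c\<in>{1..n}. \<kappa> a = \<kappa> b \<and> \<kappa> b = \<kappa> c \<and> a + b = c - 1)"
  have "\<exists>n. ?P n"
    using Schur_theorem[of r] by blast
  then have "?P (double_sum_Schur_number r)"
    unfolding double_sum_Schur_number_def by (rule LeastI_ex)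
  moreover have "\<not> ?P 0"
    by (simp add: colouring_def)
  ultimately show ?thesis
    by (metis gr0I)
qed

text \<open>The predecessor of a least number fails the defining condition, and a colouring that
  witnesses this avoids both kinds of sum. Writing \<open>c = a + b + 1\<close> keeps subtraction on
  \<open>nat\<close> out of later arguments.\<close>

lemma double_sum_Schur_number_colouring:
  obtains \<phi> where "colouring r {1..<double_sum_Schur_number r} \<phi>"
    and "\<And>a b c. \<lbrakk>a \<ge> 1; b \<ge> 1; c < double_sum_Schur_number r; c = a + b \<or> c = a + b + 1;
           \<phi> a = \<phi> b\<rbrakk> \<Longrightarrow> \<phi> b \<noteq> \<phi> c"
proof -
  define s where "s = double_sum_Schur_number r"
  define m where "m = s - 1"
  have "m < s" and interval: "{1..m} = {1..<s}"
    using double_sum_Schur_number_pos[of r] by (auto simp: m_def s_def)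
  obtain \<phi> where \<phi>: "colouring r {1..m} \<phi>"
    "\<not> (\<exists>a\<in>{1..m}. \<exists>b\<in>{1..m}. \<exists>c\<in>{1..m}. \<phi> a = \<phi> b \<and> \<phi> b = \<phi> c \<and> a + b = c)"
    "\<not> (\<exists>a\<in>{1..m}. \<exists>b\<in>{1..m}. \<exists>c\<in>{1..m}. \<phi> a = \<phi> b \<and> \<phi> b = \<phi> c \<and> a + b = c - 1)"
    using not_less_Least[OF \<open>m < s\<close>[unfolded s_def double_sum_Schur_number_def]] by blast
  show ?thesis
  proof (rule that)
    show "colouring r {1..<double_sum_Schur_number r} \<phi>"
      using \<phi>(1) interval by (simp add: s_def)
    fix a b c
    assume *: "a \<ge> 1" "b \<ge> 1" "c < double_sum_Schur_number r" "c = a + b \<or> c = a + b + 1"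
      "\<phi> a = \<phi> b"
    then have mem: "a \<in> {1..m}" "b \<in> {1..m}" "c \<in> {1..m}"
      unfolding interval s_def by auto
    have "a + b = c \<or> a + b = c - 1"
      using *(4) by auto
    then show "\<phi> b \<noteq> \<phi> c"
      using \<phi>(2,3) mem *(5) by blast
  qed
qed

section \<open>Random subsets\<close>

text \<open>Cutting both sets down to the supports changes no probability and makes them countable,
  so that the product rule for countable sets applies.\<close>

lemma prob_pair_pmf_Times:
  "measure_pmf.prob (pair_pmf M N) (A \<times> B) = measure_pmf.prob M A * measure_pmf.prob N B"
proof -
  have "measure_pmf.prob (pair_pmf M N) (A \<times> B) =
        measure_pmf.prob (pair_pmf M N) ((A \<inter> set_pmf M) \<times> (B \<inter> set_pmf N))"
    by (subst (1 2) measure_Int_set_pmf[symmetric]) (auto intro!: arg_cong2[where f = measure])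
  also have "\<dots> = measure_pmf.prob M (A \<inter> set_pmf M) * measure_pmf.prob N (B \<inter> set_pmf N)"
    by (intro measure_pmf_prob_product) (auto intro: countable_Int2)
  finally show ?thesis by (simp add: measure_Int_set_pmf)
qed

lemma prob_Pi_bernoulli_all:
  assumes "finite I" "0 \<le> p" "p \<le> 1"
  shows "measure_pmf.prob (Pi_pmf I False (\<lambda>_. bernoulli_pmf p)) {f. \<forall>i\<in>I. f i} = p ^ card I"
proof -
  have "{f. \<forall>i\<in>I. f i} = Pi I (\<lambda>_. {True})" by auto
  then show ?thesis
    using assms by (simp add: measure_Pi_pmf_Pi measure_pmf_single)
qed

text \<open>Disjoint blocks read disjoint sets of coordinates, so the events that they are entirely
  \<open>True\<close> are independent. The induction splits off one block at a time;
  \<open>I\<close> varies because the other blocks live in the smaller index set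
  \<open>J\<close>.\<close>

lemma prob_Pi_bernoulli_no_block:
  assumes "finite K" "finite I" "disjoint_family_on B K" "\<And>k. k \<in> K \<Longrightarrow> B k \<subseteq> I"
    and p: "0 \<le> p" "p \<le> 1"
  shows "measure_pmf.prob (Pi_pmf I False (\<lambda>_. bernoulli_pmf p)) {f. \<forall>k\<in>K. \<exists>i\<in>B k. \<not> f i} =
         (\<Prod>k\<in>K. 1 - p ^ card (B k))"
  using assms(1-4)
proof (induction K arbitrary: I rule: finite_induct)
  case empty
  then show ?case by simp
next
  case (insert k K)
  define J where "J = I - B k"
  let ?P = "\<lambda>I. Pi_pmf I False (\<lambda>_. bernoulli_pmf p)"
  have sub: "B k \<subseteq> I" using insert.prems by auto
  then have fin: "finite (B k)" "finite J" and I: "I = B k \<union> J"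
    using insert.prems(1) by (auto simp: J_def intro: finite_subset)
  have BJ: "B l \<subseteq> J" if "l \<in> K" for l
    using insert.prems insert.hyps that by (auto simp: J_def disjoint_family_on_def)
  have disj: "B l \<inter> B k = {}" if "l \<in> K" for l
    using BJ[OF that] by (auto simp: J_def)
  have "measure_pmf.prob (?P I) {f. \<forall>k\<in>insert k K. \<exists>i\<in>B k. \<not> f i} =
        measure_pmf.prob (pair_pmf (?P (B k)) (?P J))
          ((\<lambda>(f, g) x. if x \<in> B k then f x else g x) -` {f. \<forall>k\<in>insert k K. \<exists>i\<in>B k. \<not> f i})"
    unfolding I using fin by (subst Pi_pmf_union) (auto simp: J_def)
  \<comment> \<open>The event becomes a rectangle: the condition on \<open>B k\<close> reads only
    \<open>f\<close>, and by disjointness the conditions on the other blocks read only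
    \<open>g\<close>.\<close>
  also have "(\<lambda>(f, g) x. if x \<in> B k then f x else g x) -`
               {f. \<forall>k\<in>insert k K. \<exists>i\<in>B k. \<not> f i} =
             (- {f. \<forall>i\<in>B k. f i}) \<times> {g. \<forall>k\<in>K. \<exists>i\<in>B k. \<not> g i}"
    using disj by (fastforce simp: disjoint_iff)
  also have "measure_pmf.prob (pair_pmf (?P (B k)) (?P J)) \<dots> =
             (1 - p ^ card (B k)) * (\<Prod>k\<in>K. 1 - p ^ card (B k))"
  proof -
    have "disjoint_family_on B K"
      using insert.prems(2) by (auto simp: disjoint_family_on_def)
    then show ?thesis
      using measure_pmf.prob_compl[of "{f. \<forall>i\<in>B k. f i}" "?P (B k)"]
      by (simp add: prob_pair_pmf_Times insert.IH fin BJ prob_Pi_bernoulli_all p Compl_eq_Diff_UNIV)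
  qed
  finally show ?case using insert.hyps by simp
qed

lemma prob_random_subset_no_block:
  assumes "finite K" "disjoint_family_on B K" "\<And>k. k \<in> K \<Longrightarrow> B k \<subseteq> {1..n}"
    and "0 \<le> p" "p \<le> 1"
  shows "measure_pmf.prob (random_subset n p) {A. \<forall>k\<in>K. \<not> B k \<subseteq> A} =
         (\<Prod>k\<in>K. 1 - p ^ card (B k))"
proof -
  have "(\<lambda>f. {i \<in> {1..n}. f i}) -` {A. \<forall>k\<in>K. \<not> B k \<subseteq> A} = {f. \<forall>k\<in>K. \<exists>i\<in>B k. \<not> f i}"
    using assms(3) by (auto simp: subset_iff)
  then show ?thesis
    using prob_Pi_bernoulli_no_block[OF assms(1) _ assms(2,3,4,5)]
    by (simp add: random_subset_def)
qed

lemma set_pmf_random_subset: "A \<in> set_pmf (random_subset n p) \<Longrightarrow> A \<subseteq> {1..n}"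
  by (auto simp: random_subset_def)

lemma prob_random_subset_mem:
  assumes "0 \<le> p" "p \<le> 1" "i \<in> {1..n}"
  shows "measure_pmf.prob (random_subset n p) {A. i \<in> A} = p"
proof -
  have "measure_pmf.prob (random_subset n p) {A. \<forall>k\<in>{i}. \<not> {k} \<subseteq> A} = 1 - p"
    by (subst prob_random_subset_no_block) (use assms in \<open>auto simp: disjoint_family_on_def\<close>)
  moreover have "{A. \<forall>k\<in>{i}. \<not> {k} \<subseteq> A} = UNIV - {A. i \<in> A}" by auto
  ultimately show ?thesis
    using measure_pmf.prob_compl[of "{A. i \<in> A}" "random_subset n p"] by simp
qed

lemma prob_random_subset_hits_le:
  assumes "0 \<le> p" "p \<le> 1" "B \<subseteq> {1..n}"
  shows "measure_pmf.prob (random_subset n p) {A. A \<inter> B \<noteq> {}} \<le> real (card B) * p"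
proof -
  have "finite B" using assms(3) finite_subset by blast
  have "{A. A \<inter> B \<noteq> {}} = (\<Union>i\<in>B. {A. i \<in> A})" by auto
  then have "measure_pmf.prob (random_subset n p) {A. A \<inter> B \<noteq> {}} \<le>
               (\<Sum>i\<in>B. measure_pmf.prob (random_subset n p) {A. i \<in> A})"
    using \<open>finite B\<close> by (auto intro!: measure_pmf.finite_measure_subadditive_finite)
  also have "\<dots> = (\<Sum>i\<in>B. p)"
    using assms by (intro sum.cong prob_random_subset_mem) auto
  finally show ?thesis by simp
qed

section \<open>The lower threshold\<close>

text \<open>Colour \<open>x\<close> by the index \<open>i\<close> of the interval \<open>[n\<^bsup>i/s\<^esup>, n\<^bsup>(i+1)/s\<^esup>)\<close> containing it. A product
  of elements of intervals \<open>i\<close> and \<open>j\<close> lies in interval \<open>i + j\<close> or \<open>i + j + 1\<close>.\<close>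

lemma not_product_Schur_if_sparse:
  assumes n: "n \<ge> 2" and A: "A \<subseteq> {1..<n}"
    and large: "\<And>x. x \<in> A \<Longrightarrow> real n powr (1 / real (double_sum_Schur_number r)) < real x"
  shows "\<not> product_Schur r A"
proof -
  define s where "s = double_sum_Schur_number r"
  have s: "s > 0" by (simp add: s_def double_sum_Schur_number_pos)
  define l where "l = (\<lambda>x. real s * log (real n) (real x))"
  define \<iota> where "\<iota> = (\<lambda>x. nat \<lfloor>l x\<rfloor>)"
  obtain \<phi> where \<phi>: "colouring r {1..<s} \<phi>"
    and no_triple: "\<And>a b c. \<lbrakk>a \<ge> 1; b \<ge> 1; c < s; c = a + b \<or> c = a + b + 1; \<phi> a = \<phi> b\<rbrakk>
                      \<Longrightarrow> \<phi> b \<noteq> \<phi> c"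
    unfolding s_def using double_sum_Schur_number_colouring by metis
  have l: "1 < l x" "l x < s" if "x \<in> A" for x
  proof -
    have x: "real x > 0" "x < n" using A that by auto
    have "1 / real s < log (real n) (real x)"
      using large[OF that] n x by (subst less_log_iff) (auto simp: s_def)
    then show "1 < l x" using s by (simp add: l_def field_simps)
    have "log (real n) (real x) < 1" using n x by simp
    then show "l x < s" using s by (simp add: l_def)
  qed
  have \<iota>: "1 \<le> \<iota> x" "\<iota> x < s" if "x \<in> A" for x
    using l[OF that] by (auto simp: \<iota>_def le_nat_iff le_floor_iff nat_less_iff floor_less_iff)
  have col: "colouring r A (\<lambda>x. \<phi> (\<iota> x))"
    using \<phi> \<iota> by (auto simp: colouring_def)
  have no_product: False
    if ab: "a \<in> A" "b \<in> A" "a * b \<in> A" and eq: "\<phi> (\<iota> a) = \<phi> (\<iota> b)" "\<phi> (\<iota> b) = \<phi> (\<iota> (a * b))"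
    for a b
  proof -
    have "a > 0" "b > 0" using A ab by auto
    then have "l (a * b) = l a + l b"
      using n by (simp add: l_def log_mult distrib_left)
    \<comment> \<open>Two fractional parts add up to less than 2, so the carry is 0 or 1. These are
      exactly the two kinds of sum that \<open>\<phi>\<close> avoids.\<close>
    then have "\<lfloor>l (a * b)\<rfloor> = \<lfloor>l a\<rfloor> + \<lfloor>l b\<rfloor> \<or> \<lfloor>l (a * b)\<rfloor> = \<lfloor>l a\<rfloor> + \<lfloor>l b\<rfloor> + 1"
      by linarith
    moreover have "\<lfloor>l a\<rfloor> \<ge> 0" "\<lfloor>l b\<rfloor> \<ge> 0"
      using l[OF ab(1)] l[OF ab(2)] by auto
    ultimately have "\<iota> (a * b) = \<iota> a + \<iota> b \<or> \<iota> (a * b) = \<iota> a + \<iota> b + 1"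
      unfolding \<iota>_def by linarith
    then show ?thesis
      using no_triple[of "\<iota> a" "\<iota> b" "\<iota> (a * b)"] \<iota> ab eq by blast
  qed
  show ?thesis
  proof
    assume "product_Schur r A"
    from this[unfolded product_Schur_def, rule_format, OF col] show False
      using no_product by blast
  qed
qed

text \<open>A union bound over the at most N + 1 \<le> 2 N integers that are \<open>n\<close> itself
  or at most N, the power of \<open>n\<close> on the right. A random set that misses them all is
  sparse enough for the colouring by logarithms.\<close>

lemma prob_product_Schur_le:
  assumes n: "n \<ge> 2" and p: "0 \<le> p" "p \<le> 1"
  shows "measure_pmf.prob (random_subset n p) {A. product_Schur r A} \<le>
         2 * (real n powr (1 / real (double_sum_Schur_number r)) * p)"
proof -
  define N where "N = real n powr (1 / real (double_sum_Schur_number r))"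
  have N: "N \<ge> 1" using n by (simp add: N_def ge_one_powr_ge_zero)
  \<comment> \<open>The point \<open>n\<close> has to be avoided too: its index on the logarithmic
    scale is exactly \<open>double_sum_Schur_number r\<close>, one beyond the coloured
    interval.\<close>
  define B where "B = {i \<in> {1..n}. i \<in> {1..nat \<lfloor>N\<rfloor>} \<or> i = n}"
  have "card B \<le> card (insert n {1..nat \<lfloor>N\<rfloor>})"
    by (rule card_mono) (auto simp: B_def)
  also have "\<dots> \<le> nat \<lfloor>N\<rfloor> + 1"
    by (rule order.trans[OF card_insert_le_m1]) auto
  finally have "real (card B) \<le> 2 * N"
    using N by linarith
  have "measure_pmf.prob (random_subset n p) {A. product_Schur r A} \<le>
        measure_pmf.prob (random_subset n p) {A. A \<inter> B \<noteq> {}}"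
  \<comment> \<open>The inclusion of events holds only almost surely, because it relies on the
    random set lying in \<open>{1..n}\<close>.\<close>
  proof (rule measure_pmf.finite_measure_mono_AE)
    have "A \<inter> B \<noteq> {}" if A: "A \<in> set_pmf (random_subset n p)" "product_Schur r A" for A
    proof
      assume *: "A \<inter> B = {}"
      have sub: "A \<subseteq> {1..n}" using A(1) by (rule set_pmf_random_subset)
      have "n \<notin> A" using * n by (auto simp: B_def)
      then have "A \<subseteq> {1..<n}" using sub by (auto simp: less_le)
      moreover have "N < real x" if "x \<in> A" for x
      proof -
        have "x \<in> {1..n}" "x \<notin> B" using that sub * by auto
        then have "\<not> x \<le> nat \<lfloor>N\<rfloor>" by (auto simp: B_def)
        then show ?thesis by linarith
      qed
      ultimately show False
        using not_product_Schur_if_sparse[OF n, of A r] A(2) by (simp add: N_def)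
    qed
    then show "AE A in random_subset n p. A \<in> {A. product_Schur r A} \<longrightarrow> A \<in> {A. A \<inter> B \<noteq> {}}"
      by (simp add: AE_measure_pmf_iff)
  qed simp
  also have "\<dots> \<le> real (card B) * p"
    using p by (intro prob_random_subset_hits_le) (auto simp: B_def)
  also have "\<dots> \<le> 2 * (N * p)"
    using \<open>real (card B) \<le> 2 * N\<close> mult_right_mono[of "real (card B)" "2 * N" p] p by simp
  finally show ?thesis by (simp add: N_def)
qed

lemma prob_product_Schur_tendsto_0:
  assumes p: "\<And>n. 0 \<le> p n \<and> p n \<le> 1"
    and small: "p \<in> o(\<lambda>n. real n powr (- 1 / real (double_sum_Schur_number r)))"
  shows "(\<lambda>n. measure_pmf.prob (random_subset n (p n)) {A. product_Schur r A}) \<longlonglongrightarrow> 0"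
proof (rule tendsto_sandwich)
  let ?u = "\<lambda>n. 2 * (p n / real n powr (- 1 / real (double_sum_Schur_number r)))"
  show "(\<lambda>n. 0 :: real) \<longlonglongrightarrow> 0" by simp
  show "?u \<longlonglongrightarrow> 0"
    using tendsto_mult_right_zero[OF smalloD_tendsto[OF small]] by simp
  show "\<forall>\<^sub>F n in sequentially. measure_pmf.prob (random_subset n (p n)) {A. product_Schur r A} \<le> ?u n"
    using eventually_ge_at_top[of 2]
  proof eventually_elim
    case (elim n)
    then show ?case
      using prob_product_Schur_le[of n "p n" r] p[of n] by (simp add: powr_minus divide_simps mult.commute)
  qed
qed simp

section \<open>The upper threshold\<close>

text \<open>Colour the exponent \<open>i\<close> by the colour of \<open>x ^ i\<close>. A
  monochromatic sum of exponents then becomes a monochromatic product of powers.\<close>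

lemma product_Schur_if_powers:
  assumes "(\<lambda>i. x ^ i) ` {1..Schur_number r} \<subseteq> A"
  shows "product_Schur r A"
  unfolding product_Schur_def
proof (intro allI impI)
  fix \<kappa> assume "colouring r A \<kappa>"
  then have "colouring r {1..Schur_number r} (\<lambda>i. \<kappa> (x ^ i))"
    using assms by (auto simp: colouring_def)
  then obtain a b where ab: "a \<ge> 1" "b \<ge> 1" "a + b \<le> Schur_number r"
    "\<kappa> (x ^ a) = \<kappa> (x ^ b)" "\<kappa> (x ^ b) = \<kappa> (x ^ (a + b))"
    by (rule Schur_number_triple) auto
  then have "x ^ a \<in> A" "x ^ b \<in> A" "x ^ (a + b) \<in> A"
    using assms by auto
  then show "\<exists>a\<in>A. \<exists>b\<in>A. \<exists>c\<in>A. \<kappa> a = \<kappa> b \<and> \<kappa> b = \<kappa> c \<and> a * b = c"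
    using ab
    by (intro bexI[of _ "x ^ a"] bexI[of _ "x ^ b"] bexI[of _ "x ^ (a + b)"])
       (auto simp: power_add)
qed

text \<open>The exponent \<open>i\<close> is recovered from \<open>(4 k + 2)\<^bsup>i\<^esup>\<close> as its 2-adic valuation.\<close>

lemma power_4_mult_add_2_inj:
  fixes k l i j :: nat
  assumes "(4 * k + 2) ^ i = (4 * l + 2) ^ j" "i \<ge> 1"
  shows "i = j \<and> k = l"
proof -
  have val: "multiplicity 2 ((4 * k + 2) ^ i) = i" for k i :: nat
  proof -
    have "(4 * k + 2) ^ i = 2 ^ i * (2 * k + 1) ^ i"
      by (simp flip: power_mult_distrib)
    moreover have "\<not> 2 dvd (2 * k + 1) ^ i" by simp
    ultimately show ?thesis
      by (intro multiplicity_eqI) (auto simp: power_Suc2 mult.assoc simp del: power_Suc)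
  qed
  have "i = multiplicity 2 ((4 * k + 2) ^ i)" by (simp only: val)
  also have "\<dots> = multiplicity 2 ((4 * l + 2) ^ j)" by (simp only: assms(1))
  also have "\<dots> = j" by (simp only: val)
  finally have "i = j" .
  moreover have "4 * k + 2 = 4 * l + 2"
  proof (rule power_eq_imp_eq_base)
    show "(4 * k + 2) ^ i = (4 * l + 2) ^ i"
      using assms(1) unfolding \<open>i = j\<close> .
  qed (use assms(2) in simp_all)
  ultimately show ?thesis by simp
qed

text \<open>One block of powers contained in the random set suffices. The bases
  \<open>4 * k + 2\<close> with \<open>k < m\<close> give \<open>m\<close> disjoint blocks, all
  below \<open>(4 * m) ^ S\<close> and hence inside \<open>{1..n}\<close>, and the probability of
  missing every block is bounded by 1 - x \<le> exp (-x).\<close>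

lemma prob_product_Schur_ge:
  assumes n: "(4 * m) ^ Schur_number r \<le> n" and p: "0 \<le> p" "p \<le> 1"
  shows "measure_pmf.prob (random_subset n p) {A. product_Schur r A} \<ge>
         1 - exp (- (real m * p ^ Schur_number r))"
proof -
  define S where "S = Schur_number r"
  define B where "B = (\<lambda>k::nat. (\<lambda>i. (4 * k + 2) ^ i) ` {1..S})"
  let ?none = "{A. \<forall>k\<in>{..<m}. \<not> B k \<subseteq> A}"
  have card: "card (B k) = S" for k
    unfolding B_def by (subst card_image) (auto simp: inj_on_def)
  have disj: "disjoint_family_on B {..<m}"
    unfolding disjoint_family_on_def B_def
  proof (intro ballI impI equals0I)
    fix k l x :: nat
    assume "k \<noteq> l"
      and "x \<in> (\<lambda>i. (4 * k + 2) ^ i) ` {1..S} \<inter> (\<lambda>i. (4 * l + 2) ^ i) ` {1..S}"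
    then obtain i j where "x = (4 * k + 2) ^ i" "x = (4 * l + 2) ^ j" "i \<in> {1..S}"
      by blast
    then show False
      using power_4_mult_add_2_inj[of k i l j] \<open>k \<noteq> l\<close> by (metis atLeastAtMost_iff)
  qed
  have sub: "B k \<subseteq> {1..n}" if "k < m" for k
  proof -
    have "(4 * k + 2) ^ i \<le> n" if "i \<le> S" for i
    proof -
      have "(4 * k + 2) ^ i \<le> (4 * k + 2) ^ S" using that by (intro power_increasing) simp_all
      also have "\<dots> \<le> (4 * m) ^ S" using \<open>k < m\<close> by (intro power_mono) simp_all
      also have "\<dots> \<le> n" using n unfolding S_def .
      finally show ?thesis .
    qed
    then show ?thesis by (auto simp: B_def Suc_le_eq)
  qed
  have "measure_pmf.prob (random_subset n p) ?none = (1 - p ^ S) ^ m"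
    using prob_random_subset_no_block[OF _ disj sub p] by (simp add: card)
  also have "\<dots> \<le> exp (- (p ^ S)) ^ m"
    using p exp_ge_add_one_self[of "- (p ^ S)"] by (intro power_mono) (auto simp: power_le_one)
  also have "\<dots> = exp (- (real m * p ^ S))"
    by (simp flip: exp_of_nat_mult)
  finally have "1 - exp (- (real m * p ^ S)) \<le> measure_pmf.prob (random_subset n p) (UNIV - ?none)"
    using measure_pmf.prob_compl[of ?none "random_subset n p"] by simp
  also have "\<dots> \<le> measure_pmf.prob (random_subset n p) {A. product_Schur r A}"
  proof (rule measure_pmf.finite_measure_mono)
    show "UNIV - ?none \<subseteq> {A. product_Schur r A}"
      unfolding B_def S_def using product_Schur_if_powers by blast
  qed simp
  finally show ?thesis by (simp add: S_def)
qed

text \<open>With N = n^(1/S), the number \<open>m\<close> of available blocks is at least N / 8 for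
  large \<open>n\<close>, while \<open>p n ^ S\<close> eventually exceeds any fixed multiple of 1 /
  N. So the expected number \<open>m * p n ^ S\<close> of complete blocks grows without
  bound.\<close>

lemma prob_product_Schur_tendsto_1:
  assumes p: "\<And>n. 0 \<le> p n \<and> p n \<le> 1"
    and large: "p \<in> \<omega>(\<lambda>n. real n powr (- 1 / real ((Schur_number r)\<^sup>2)))"
  shows "(\<lambda>n. measure_pmf.prob (random_subset n (p n)) {A. product_Schur r A}) \<longlonglongrightarrow> 1"
proof (rule order_tendstoI)
  define S where "S = Schur_number r"
  have S: "S > 0" by (simp add: S_def Schur_number_pos)
  fix a :: real
  assume "a < 1"
  \<comment> \<open>The second argument makes exp (-c / 8) fall strictly below 1 - a. The bound c
    \<ge> 1 ensures c \<le> c^S when the estimate for \<open>p n\<close> is raised to the power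
    \<open>S\<close>.\<close>
  define c where "c = max 1 (- 8 * ln (1 - a) + 1)"
  have c: "c \<ge> 1" and "- 8 * ln (1 - a) + 1 \<le> c" by (simp_all add: c_def)
  then have "- c / 8 < ln (1 - a)" by linarith
  then have "exp (- c / 8) < 1 - a"
    using \<open>a < 1\<close> by (metis diff_gt_0_iff_gt exp_less_cancel_iff exp_ln)
  have "\<forall>\<^sub>F n in sequentially. norm (p n) \<ge> c * norm (real n powr (- 1 / real (S\<^sup>2)))"
    using large c unfolding smallomega_def S_def by auto
  then show "\<forall>\<^sub>F n in sequentially.
      a < measure_pmf.prob (random_subset n (p n)) {A. product_Schur r A}"
    \<comment> \<open>This gives N \<ge> 8 below, hence N / 4 - 1 \<ge> N / 8: rounding N / 4 down
      loses at most a factor 2.\<close>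
    using eventually_ge_at_top[of "8 ^ S"]
  proof eventually_elim
    case (elim n)
    define N where "N = real n powr (1 / real S)"
    define m where "m = nat \<lfloor>N / 4\<rfloor>"
    have "n > 0" using elim(2) by (rule less_le_trans[rotated]) simp
    then have NS: "N ^ S = real n"
      using S by (simp add: N_def powr_power)
    have "real (8 ^ S) \<le> real n"
      using elim(2) by (simp only: of_nat_le_iff)
    then have "8 ^ S \<le> N ^ S"
      by (simp add: NS)
    then have N: "N \<ge> 8"
      using S by (simp add: power_mono_iff N_def)
    then have m: "real m \<ge> N / 8" "real (4 * m) \<le> N" unfolding m_def by linarith+
    have "real ((4 * m) ^ S) \<le> real n"
      using power_mono[OF m(2), of S] NS by simp
    then have mn: "(4 * m) ^ Schur_number r \<le> n" by (simp only: of_nat_le_iff S_def)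
    have "c * (1 / N) \<le> c ^ S * (1 / N)"
      using c N self_le_power[of c S] S by (intro mult_right_mono) auto
    also have "\<dots> = (c * real n powr (- 1 / real (S\<^sup>2))) ^ S"
    proof -
      have "real S * (- 1 / real (S\<^sup>2)) = - (1 / real S)"
        using S by (simp add: power2_eq_square)
      moreover have "(real n powr (- 1 / real (S\<^sup>2))) ^ S =
                     real n powr (real S * (- 1 / real (S\<^sup>2)))"
        using \<open>n > 0\<close> by (intro powr_power) simp
      ultimately have "(real n powr (- 1 / real (S\<^sup>2))) ^ S = 1 / N"
        by (simp only: N_def powr_minus_divide)
      then show ?thesis by (simp only: power_mult_distrib)
    qed
    also have "\<dots> \<le> p n ^ S"
      using elim p[of n] c by (intro power_mono) auto
    finally have "c / 8 \<le> N / 8 * p n ^ S"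
      using N by (simp add: field_simps)
    also have "\<dots> \<le> real m * p n ^ S"
      using m p[of n] by (intro mult_right_mono) auto
    finally have "exp (- (real m * p n ^ S)) \<le> exp (- c / 8)" by simp
    also have "\<dots> < 1 - a" by fact
    finally show ?case
      using prob_product_Schur_ge[OF mn, of "p n"] p[of n] by (simp add: S_def)
  qed
next
  fix a :: real
  assume "1 < a"
  then show "\<forall>\<^sub>F n in sequentially.
      measure_pmf.prob (random_subset n (p n)) {A. product_Schur r A} < a"
    by (intro always_eventually allI le_less_trans[OF measure_pmf.prob_le_1])
qed

theorem theorem1p4:
  fixes r :: nat and p :: "nat \<Rightarrow> real"
  assumes "r \<ge> 2"
    and "\<And>n. 0 \<le> p n \<and> p n \<le> 1"
  shows "(p \<in> o(\<lambda>n. real n powr (- 1 / real (double_sum_Schur_number r))) \<longrightarrow>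
           (\<lambda>n. measure_pmf.prob (random_subset n (p n)) {A. product_Schur r A}) \<longlonglongrightarrow> 0) \<and>
         (p \<in> \<omega>(\<lambda>n. real n powr (- 1 / real ((Schur_number r)\<^sup>2))) \<longrightarrow>
           (\<lambda>n. measure_pmf.prob (random_subset n (p n)) {A. product_Schur r A}) \<longlonglongrightarrow> 1)"
  using prob_product_Schur_tendsto_0[of p r] prob_product_Schur_tendsto_1[of p r] assms(2)
  by simp

end
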